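(* Let $\mathfrak R$ be a Radon probability measure on $[0,1]$. Suppose $(\hat\sigma_j)_{j\ge1}$ is a sequence of Borel probability measures on $[0,1]$ such that $D_{\mathrm{KL}}(\hat\sigma_j\|\mathfrak R)$ is uniformly bounded in $j$ by a finite constant. If $\hat\sigma_j$ converges weakly to $\hat\sigma$ as $j\to\infty$, then $$\lim_{j\to\infty}\int f\,d\hat\sigma_j=\int f\,d\hat\sigma$$ for every measurable $f:[0,1]\to\mathbb R$ satisfying $\int e^{\alpha|f(u)|^\beta}\,\mathfrak R(du)<\infty$ for some $\alpha>0$ and $\beta>1$. In particular, $\hat\sigma_j(B)\to\hat\sigma(B)$ for every measurable $B\subset[0,1]$.
   Context: For Borel probability measures on $[0,1]$, $D_{\mathrm{KL}}(\hat\sigma\|\mathfrak R)=\int_0^1\log\frac{d\hat\sigma}{d\mathfrak R}\,d\hat\sigma$ if $\hat\sigma\ll\mathfrak R$, and $+\infty$ otherwise (relative entropy, or Kullback--Leibler divergence). *)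

theory Defs
  imports "HOL-Probability.Probability"
begin

definition unit_borel :: "real measure" where
  "unit_borel = restrict_space borel {0..1}"

definition borel_prob_unit :: "real measure \<Rightarrow> bool" where
  "borel_prob_unit \<mu> \<longleftrightarrow> prob_space \<mu> \<and> sets \<mu> = sets unit_borel"

text \<open>Local finiteness is automatic for probability measures, so being Radon amounts to
  inner regularity with respect to compact sets.\<close>

definition radon_prob_unit :: "real measure \<Rightarrow> bool" where
  "radon_prob_unit \<mu> \<longleftrightarrow> borel_prob_unit \<mu> \<and>
     (\<forall>A\<in>sets \<mu>. emeasure \<mu> A = (SUP K\<in>{K. compact K \<and> K \<subseteq> A}. emeasure \<mu> K))"

text \<open>The library constant \<^const>\<open>weak_conv_m\<close> compares distribution functions of measures on the
  whole real line; for measures on the unit interval we test against continuous functions,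
  which are bounded by compactness.\<close>

definition weak_conv_unit :: "(nat \<Rightarrow> real measure) \<Rightarrow> real measure \<Rightarrow> bool" where
  "weak_conv_unit \<sigma>s \<sigma> \<longleftrightarrow>
     (\<forall>g::real \<Rightarrow> real. continuous_on {0..1} g \<longrightarrow>
        (\<lambda>j. integral\<^sup>L (\<sigma>s j) g) \<longlonglongrightarrow> integral\<^sup>L \<sigma> g)"

text \<open>The relative entropy of \<open>\<sigma>\<close> with respect to \<open>R\<close>. The integral of the logarithmic density is
  taken in the extended sense, as the difference of the integrals of its positive and negative
  parts: the Bochner integral underlying \<^const>\<open>KL_divergence\<close> would be \<open>0\<close> instead of \<open>\<infinity>\<close> when
  the density is not integrable. The reference measure is the first argument of
  \<^const>\<open>entropy_density\<close> and \<^const>\<open>KL_divergence\<close>.\<close>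

definition rel_entropy :: "real measure \<Rightarrow> real measure \<Rightarrow> ereal" where
  "rel_entropy \<sigma> R =
     (if absolutely_continuous R \<sigma> then
        enn2ereal (\<integral>\<^sup>+x. ennreal (entropy_density (exp 1) R \<sigma> x) \<partial>\<sigma>) -
        enn2ereal (\<integral>\<^sup>+x. ennreal (- entropy_density (exp 1) R \<sigma> x) \<partial>\<sigma>)
      else \<infinity>)"

lemma rel_entropy_eq_KL_divergence:
  assumes "absolutely_continuous R \<sigma>" and "integrable \<sigma> (entropy_density (exp 1) R \<sigma>)"
  shows "rel_entropy \<sigma> R = ereal (KL_divergence (exp 1) R \<sigma>)"
proof -
  let ?P = "\<integral>\<^sup>+x. ennreal (entropy_density (exp 1) R \<sigma> x) \<partial>\<sigma>"
  let ?N = "\<integral>\<^sup>+x. ennreal (- entropy_density (exp 1) R \<sigma> x) \<partial>\<sigma>"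
  have fin: "?P \<noteq> \<infinity>" "?N \<noteq> \<infinity>"
    using assms(2) by (auto simp: real_integrable_def)
  then obtain p n where "?P = ennreal p" "p \<ge> 0" "?N = ennreal n" "n \<ge> 0"
    by (metis ennreal_cases infinity_ennreal_def)
  then show ?thesis
    using assms by (simp add: rel_entropy_def KL_divergence_def real_lebesgue_integral_def
        enn2ereal_ennreal)
qed

end

theory Submission
  imports Defs
begin

text \<open>Integrating Young's inequality \<open>a b \<le> a ln a - a + exp b\<close> shows that a bound on the relative
  entropy controls \<open>t \<integral> g d\<sigma>\<^sub>j\<close> by the exponential moment \<open>\<integral> exp (t g) dR\<close>, for all \<open>g \<ge> 0\<close> and
  \<open>t > 0\<close>. For indicators this makes the measures uniformly absolutely continuous with respect to
  \<open>R\<close>, which upgrades weak to setwise convergence by sandwiching a Borel set between a compact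
  and a relatively open set. Setwise convergence gives convergence of the integrals of bounded
  functions, and for the tails of \<open>f\<close> the moment bound yields uniform integrability, because
  \<open>\<beta> > 1\<close> makes all exponential moments of \<open>f\<close> finite.\<close>

section \<open>Young's inequality and entropy duality\<close>

lemma mult_ln_ge:
  fixes a :: real
  assumes "0 \<le> a"
  shows "a - 1 \<le> a * ln a"
proof (cases "a = 0")
  case False
  with assms have "0 < a" by simp
  then have "ln (1 / a) \<le> 1 / a - 1" by (intro ln_le_minus_one) simp
  then show ?thesis using \<open>0 < a\<close> by (simp add: ln_div field_simps)
qed simp

text \<open>\<open>a * ln a - a\<close> and \<open>exp b\<close> are convex conjugates: this is
  \<open>1 + s \<le> exp s\<close> at \<open>s = b - ln a\<close>, multiplied by
  \<open>a\<close>.\<close>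

lemma young_exp_ln:
  fixes a b :: real
  assumes "0 \<le> a"
  shows "a * b \<le> a * ln a - a + exp b"
proof (cases "a = 0")
  case False
  with assms have a: "0 < a" by simp
  have "1 + (b - ln a) \<le> exp (b - ln a)" by (rule exp_ge_add_one_self)
  also have "\<dots> = exp b / a" using a by (simp add: exp_diff)
  finally show ?thesis using a by (simp add: field_simps)
qed simp

text \<open>The bound excludes the infinite branch of \<open>rel_entropy\<close>, so Radon-Nikodym
  supplies a density. Turning the extended difference into an ordinary integral then requires both
  of its parts to be finite.\<close>

lemma rel_entropy_densityE:
  assumes "prob_space R" "prob_space \<sigma>" "sets \<sigma> = sets R" and le: "rel_entropy \<sigma> R \<le> ereal C"
  obtains D where "D \<in> borel_measurable R" "\<And>x. 0 \<le> D x"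
    "\<sigma> = density R (\<lambda>x. ennreal (D x))"
    "integrable R (\<lambda>x. D x * ln (D x))" "(\<integral>x. D x * ln (D x) \<partial>R) \<le> C"
proof -
  interpret R: prob_space R by fact
  interpret \<sigma>: prob_space \<sigma> by fact
  have ac: "absolutely_continuous R \<sigma>"
    using le by (auto simp: rel_entropy_def split: if_splits)
  obtain D where D[measurable]: "D \<in> borel_measurable R"
    and RN: "AE x in R. RN_deriv R \<sigma> x = ennreal (D x)" and nn: "\<And>x. 0 \<le> D x"
    using R.real_RN_deriv[OF \<sigma>.finite_measure_axioms ac assms(3)] by metis
  have "density R (RN_deriv R \<sigma>) = \<sigma>" using ac assms(3) by (rule R.density_RN_deriv)
  moreover have "density R (RN_deriv R \<sigma>) = density R (\<lambda>x. ennreal (D x))"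
    using RN by (intro density_cong) auto
  ultimately have dens: "\<sigma> = density R (\<lambda>x. ennreal (D x))" by simp
  let ?e = "entropy_density (exp 1) R \<sigma>"
  have meas_eq: "borel_measurable \<sigma> = (borel_measurable R :: (real \<Rightarrow> real) set)"
    by (rule measurable_cong_sets) (use assms in auto)
  have e[measurable]: "?e \<in> borel_measurable R" by simp
  have e': "?e \<in> borel_measurable \<sigma>" by (simp add: meas_eq)
  have ln_eq: "AE x in R. ?e x = ln (D x)"
    using RN by eventually_elim (simp add: entropy_density_def nn log_def)
  \<comment> \<open>Under \<open>R\<close> the integrand becomes the negative part of
    \<open>D * ln D\<close>, and \<open>- a * ln a \<le> 1 - a \<le> 1\<close>. Hence the entropy is
    never of the form infinity minus infinity.\<close>
  have neg: "(\<integral>\<^sup>+x. ennreal (- ?e x) \<partial>\<sigma>) \<le> 1"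
  proof -
    have "(\<integral>\<^sup>+x. ennreal (- ?e x) \<partial>\<sigma>) = (\<integral>\<^sup>+x. ennreal (D x) * ennreal (- ?e x) \<partial>R)"
      by (subst dens, rule nn_integral_density) auto
    also have "\<dots> \<le> (\<integral>\<^sup>+x. 1 \<partial>R)"
    proof (rule nn_integral_mono_AE)
      show "AE x in R. ennreal (D x) * ennreal (- ?e x) \<le> 1"
        using ln_eq
      proof eventually_elim
        case (elim x)
        have "D x * - ln (D x) \<le> 1" using mult_ln_ge[OF nn[of x]] nn[of x] by simp
        then show ?case using elim nn[of x]
          by (metis ennreal_leI ennreal_mult' ennreal_1)
      qed
    qed
    finally show ?thesis by (simp add: R.emeasure_space_1)
  qed
  then have neg_fin: "(\<integral>\<^sup>+x. ennreal (- ?e x) \<partial>\<sigma>) \<noteq> \<infinity>"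
    by (auto simp: top_unique)
  \<comment> \<open>As the negative part is finite, an infinite positive part would make the entropy
    infinite, against the bound \<open>C\<close>.\<close>
  have pos_fin: "(\<integral>\<^sup>+x. ennreal (?e x) \<partial>\<sigma>) \<noteq> \<infinity>"
  proof
    assume "(\<integral>\<^sup>+x. ennreal (?e x) \<partial>\<sigma>) = \<infinity>"
    moreover obtain n where "(\<integral>\<^sup>+x. ennreal (- ?e x) \<partial>\<sigma>) = ennreal n" "0 \<le> n"
      using neg_fin by (metis ennreal_cases infinity_ennreal_def)
    ultimately show False
      using le ac by (simp add: rel_entropy_def enn2ereal_ennreal)
  qed
  have int_e: "integrable \<sigma> ?e"
    using pos_fin neg_fin e' by (simp add: real_integrable_def)
  have KL: "integral\<^sup>L \<sigma> ?e \<le> C"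
    using le rel_entropy_eq_KL_divergence[OF ac int_e] by (simp add: KL_divergence_def)
  have ae: "AE x in R. D x * ?e x = D x * ln (D x)"
    using ln_eq by eventually_elim simp
  have "integrable R (\<lambda>x. D x * ?e x)"
    using int_e integrable_density[of ?e R D] nn dens by simp
  then have "integrable R (\<lambda>x. D x * ln (D x))"
    using integrable_cong_AE[OF _ _ ae] by simp
  moreover have "integral\<^sup>L \<sigma> ?e = (\<integral>x. D x * ?e x \<partial>R)"
    using integral_density[of ?e R D] nn dens by simp
  then have "(\<integral>x. D x * ln (D x) \<partial>R) \<le> C"
    using KL integral_cong_AE[OF _ _ ae] by simp
  ultimately show thesis using that D nn dens by blast
qed

text \<open>Young's inequality with \<open>a = D x\<close> and \<open>b = t * g x\<close>,
  integrated against \<open>R\<close>. This is the Donsker-Varadhan bound with the logarithm of the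
  exponential moment relaxed to the moment minus 1.\<close>

lemma rel_entropy_duality:
  fixes g :: "real \<Rightarrow> real"
  assumes "prob_space R" "prob_space \<sigma>" "sets \<sigma> = sets R" "rel_entropy \<sigma> R \<le> ereal C"
    and g[measurable]: "g \<in> borel_measurable R" and g_nn: "\<And>x. 0 \<le> g x" and "0 < t"
    and exp_int: "integrable R (\<lambda>x. exp (t * g x))"
  shows "integrable \<sigma> g" "t * (\<integral>x. g x \<partial>\<sigma>) \<le> C - 1 + (\<integral>x. exp (t * g x) \<partial>R)"
proof -
  interpret R: prob_space R by fact
  interpret \<sigma>: prob_space \<sigma> by fact
  obtain D where D[measurable]: "D \<in> borel_measurable R" and nn: "\<And>x. 0 \<le> D x"
    and dens: "\<sigma> = density R (\<lambda>x. ennreal (D x))"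
    and ent: "integrable R (\<lambda>x. D x * ln (D x))" "(\<integral>x. D x * ln (D x) \<partial>R) \<le> C"
    by (rule rel_entropy_densityE[OF assms(1-4)], rule that)
  \<comment> \<open>The total mass of \<open>\<sigma>\<close>, read through the density, gives
    \<open>D\<close> the integral 1; this is the source of \<open>- 1\<close> in the bound.\<close>
  have "integrable \<sigma> (\<lambda>_. 1 :: real)" by simp
  then have D_int: "integrable R D"
    using integrable_density[of "\<lambda>_. 1 :: real" R D] nn dens by simp
  have "(\<integral>x. D x \<partial>R) = (\<integral>x. 1 \<partial>\<sigma>)"
    using integral_density[of "\<lambda>_. 1 :: real" R D] nn dens by simp
  then have D_1: "(\<integral>x. D x \<partial>R) = 1" by (simp add: \<sigma>.prob_space)
  let ?h = "\<lambda>x. D x * ln (D x) - D x + exp (t * g x)"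
  have h_int: "integrable R ?h"
    using ent D_int exp_int by simp
  have le: "D x * (t * g x) \<le> ?h x" for x
    by (rule young_exp_ln[OF nn])
  \<comment> \<open>Since \<open>g\<close> is nonnegative, the one-sided Young bound is also a bound
    on the norm.\<close>
  have tg: "integrable R (\<lambda>x. D x * (t * g x))"
  proof (rule Bochner_Integration.integrable_bound[OF h_int])
    show "AE x in R. norm (D x * (t * g x)) \<le> norm (?h x)"
    proof (rule AE_I2)
      fix x
      have "0 \<le> D x * (t * g x)" using nn g_nn \<open>0 < t\<close> by simp
      then show "norm (D x * (t * g x)) \<le> norm (?h x)" using le[of x] by simp
    qed
  qed simp
  moreover have "(\<lambda>x. D x * (t * g x)) = (\<lambda>x. t * (D x * g x))" by (simp add: ac_simps)
  ultimately have "integrable R (\<lambda>x. D x * g x)" using \<open>0 < t\<close> by simp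
  then show "integrable \<sigma> g"
    using integrable_density[of g R D] nn dens by simp
  have "t * (\<integral>x. g x \<partial>\<sigma>) = (\<integral>x. D x * (t * g x) \<partial>R)"
    using integral_density[of g R D] nn dens by (simp add: mult.left_commute)
  also have "\<dots> \<le> (\<integral>x. ?h x \<partial>R)"
    using tg h_int le by (intro integral_mono) auto
  also have "\<dots> \<le> C - 1 + (\<integral>x. exp (t * g x) \<partial>R)"
    using ent D_int exp_int D_1 by simp
  finally show "t * (\<integral>x. g x \<partial>\<sigma>) \<le> C - 1 + (\<integral>x. exp (t * g x) \<partial>R)" .
qed

text \<open>Duality for the indicator of \<open>A\<close> gives \<open>t * measure (\<sigma>s j) A
  \<le> C + (exp t - 1) * measure R A\<close>. A large \<open>t\<close> absorbs \<open>C\<close>; a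
  small \<open>measure R A\<close> then absorbs the rest.\<close>

lemma rel_entropy_uniform_absolute_continuity:
  assumes R: "prob_space R" and "\<And>j::nat. prob_space (\<sigma>s j)" "\<And>j. sets (\<sigma>s j) = sets R"
    and "\<And>j. rel_entropy (\<sigma>s j) R \<le> ereal C" and "0 < \<epsilon>"
  obtains \<delta> where "0 < \<delta>" "\<And>A j. A \<in> sets R \<Longrightarrow> measure R A < \<delta> \<Longrightarrow> measure (\<sigma>s j) A < \<epsilon>"
proof
  interpret R: prob_space R by fact
  \<comment> \<open>\<open>t\<close> makes \<open>\<bar>C\<bar> / t\<close> less than
    \<open>\<epsilon> / 2\<close>, with \<open>+ 1\<close> keeping it positive when
    \<open>C = 0\<close>; \<open>\<delta>\<close> solves
    \<open>(exp t - 1) * \<delta> = \<epsilon> * t / 2\<close>.\<close>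
  define t where "t = 2 * \<bar>C\<bar> / \<epsilon> + 1"
  have t: "0 < t" "2 * \<bar>C\<bar> < \<epsilon> * t" using \<open>0 < \<epsilon>\<close> by (auto simp: t_def field_simps intro!: add_pos_nonneg)
  define \<delta> where "\<delta> = \<epsilon> * t / (2 * (exp t - 1))"
  have et: "0 < exp t - 1" using t by simp
  show "0 < \<delta>" using t et \<open>0 < \<epsilon>\<close> by (simp add: \<delta>_def)
  fix A j assume A[measurable]: "A \<in> sets R" and small: "measure R A < \<delta>"
  have *: "exp (t * indicator A x) = 1 + (exp t - 1) * (indicator A x :: real)" for x
    by (simp split: split_indicator)
  have [simp]: "integrable R (indicator A :: real \<Rightarrow> real)"
    by (rule integrable_real_indicator) (auto simp: R.emeasure_finite less_top[symmetric])
  have "integrable R (\<lambda>x. exp (t * indicator A x))" unfolding * by simp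
  then have "t * (\<integral>x. indicator A x \<partial>\<sigma>s j) \<le> C - 1 + (\<integral>x. exp (t * indicator A x) \<partial>R)"
    by (intro rel_entropy_duality(2)[OF R assms(2-4) _ _ t(1)]) auto
  also have "(\<integral>x. exp (t * indicator A x) \<partial>R) = 1 + (exp t - 1) * measure R A"
    unfolding * by (simp add: R.prob_space)
  finally have "t * measure (\<sigma>s j) A \<le> C + (exp t - 1) * measure R A"
    using A assms(3) by simp
  also have "(exp t - 1) * measure R A < (exp t - 1) * \<delta>"
    using small et by (rule mult_strict_left_mono)
  also have "(exp t - 1) * \<delta> = \<epsilon> * t / 2" using et by (simp add: \<delta>_def field_simps)
  finally have "t * measure (\<sigma>s j) A < \<epsilon> * t" using t(2) abs_ge_self[of C] by linarith
  then show "measure (\<sigma>s j) A < \<epsilon>" using t(1) by (simp add: mult.commute[of t])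
qed

section \<open>Setwise convergence and integrals\<close>

text \<open>A three-epsilon argument: the approximation error is uniform in \<open>j\<close>, so
  only the approximants have to converge.\<close>

lemma tendsto_by_approximation:
  fixes X :: "nat \<Rightarrow> real"
  assumes "\<And>\<epsilon>. 0 < \<epsilon> \<Longrightarrow> \<exists>Y y. Y \<longlonglongrightarrow> y \<and> (\<forall>j. \<bar>X j - Y j\<bar> \<le> \<epsilon>) \<and> \<bar>x - y\<bar> \<le> \<epsilon>"
  shows "X \<longlonglongrightarrow> x"
proof (rule tendstoI)
  fix e :: real assume "0 < e"
  then obtain Y y where Y: "Y \<longlonglongrightarrow> y" "\<And>j. \<bar>X j - Y j\<bar> \<le> e / 3" "\<bar>x - y\<bar> \<le> e / 3"
    using assms[of "e / 3"] by auto
  have "\<forall>\<^sub>F j in sequentially. dist (Y j) y < e / 3"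
    using \<open>0 < e\<close> by (intro tendstoD[OF Y(1)]) simp
  then show "\<forall>\<^sub>F j in sequentially. dist (X j) x < e"
  proof eventually_elim
    case (elim j)
    then show ?case using Y(2)[of j] Y(3) unfolding dist_real_def by linarith
  qed
qed

text \<open>Rounding \<open>f\<close> down to multiples of \<open>1 / n\<close> costs at most
  \<open>1 / n\<close> and leaves a simple function, whose integral is a finite combination of
  measures of sets.\<close>

lemma setwise_tendsto_integral_bounded:
  fixes f :: "'a \<Rightarrow> real"
  assumes "\<And>j. prob_space (\<sigma>s j)" "prob_space \<sigma>" and sets: "\<And>j. sets (\<sigma>s j) = sets \<sigma>"
    and setwise: "\<And>B. B \<in> sets \<sigma> \<Longrightarrow> (\<lambda>j. measure (\<sigma>s j) B) \<longlonglongrightarrow> measure \<sigma> B"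
    and f[measurable]: "f \<in> borel_measurable \<sigma>" and bdd: "\<And>x. \<bar>f x\<bar> \<le> M"
  shows "(\<lambda>j. \<integral>x. f x \<partial>\<sigma>s j) \<longlonglongrightarrow> (\<integral>x. f x \<partial>\<sigma>)"
proof (rule tendsto_by_approximation)
  fix \<epsilon> :: real assume "0 < \<epsilon>"
  then obtain n :: nat where n: "0 < n" "1 / n < \<epsilon>"
    using nat_approx_posE by (metis zero_less_Suc)
  \<comment> \<open>Since \<open>\<bar>n * f x\<bar> \<le> n * M\<close>, this finite range contains
    every value of \<open>\<lfloor>n * f x\<rfloor>\<close>.\<close>
  define S where "S = {- \<lceil>n * M\<rceil> - 1..\<lceil>n * M\<rceil>}"
  define A where "A k = {x \<in> space \<sigma>. \<lfloor>n * f x\<rfloor> = k}" for k :: int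
  define g where "g x = (\<Sum>k\<in>S. k / n * indicator (A k) x :: real)" for x
  have A[measurable]: "A k \<in> sets \<sigma>" for k by (simp add: A_def)
  have g_eq: "g x = \<lfloor>n * f x\<rfloor> / n" if "x \<in> space \<sigma>" for x
  proof -
    have "\<bar>n * f x\<bar> \<le> n * M" using bdd[of x] n by (simp add: abs_mult)
    then have "\<lfloor>n * f x\<rfloor> \<in> S" by (auto simp: S_def) linarith+
    moreover have "finite S" by (simp add: S_def)
    moreover have "g x = (\<Sum>k\<in>S. if k = \<lfloor>n * f x\<rfloor> then k / n else 0)"
      unfolding g_def by (rule sum.cong) (use that in \<open>auto simp: A_def\<close>)
    ultimately show ?thesis by simp
  qed
  have close: "\<bar>f x - g x\<bar> \<le> 1 / n" if "x \<in> space \<sigma>" for x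
  proof -
    have "f x - g x = (n * f x - \<lfloor>n * f x\<rfloor>) / n"
      using n by (simp add: g_eq[OF that] diff_divide_distrib)
    moreover have "\<bar>n * f x - \<lfloor>n * f x\<rfloor>\<bar> \<le> 1" by linarith
    ultimately show ?thesis by (simp add: divide_right_mono)
  qed
  \<comment> \<open>A general \<open>\<nu>\<close> covers every \<open>\<sigma>s j\<close> and the
    limit \<open>\<sigma>\<close> alike.\<close>
  have integrals: "(\<integral>x. g x \<partial>\<nu>) = (\<Sum>k\<in>S. k / n * measure \<nu> (A k))"
    "\<bar>(\<integral>x. f x \<partial>\<nu>) - (\<integral>x. g x \<partial>\<nu>)\<bar> \<le> \<epsilon>"
    if "prob_space \<nu>" and [measurable_cong]: "sets \<nu> = sets \<sigma>" for \<nu>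
  proof -
    interpret \<nu>: prob_space \<nu> by fact
    have sp: "space \<nu> = space \<sigma>" using that(2) by (rule sets_eq_imp_space_eq)
    have Ai: "integrable \<nu> (\<lambda>x. k / n * indicator (A k) x :: real)" for k
      by (intro integrable_mult_right integrable_real_indicator)
        (auto simp: \<nu>.emeasure_finite less_top[symmetric])
    show "(\<integral>x. g x \<partial>\<nu>) = (\<Sum>k\<in>S. k / n * measure \<nu> (A k))"
      unfolding g_def using Ai by (subst Bochner_Integration.integral_sum) auto
    have fi: "integrable \<nu> f"
      by (rule \<nu>.integrable_const_bound[of _ M]) (use bdd in auto)
    have gi: "integrable \<nu> g"
      unfolding g_def using Ai by (rule Bochner_Integration.integrable_sum)
    have "\<bar>(\<integral>x. f x \<partial>\<nu>) - (\<integral>x. g x \<partial>\<nu>)\<bar> = \<bar>\<integral>x. f x - g x \<partial>\<nu>\<bar>"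
      using fi gi by simp
    also have "\<dots> \<le> (\<integral>x. \<bar>f x - g x\<bar> \<partial>\<nu>)" by (rule integral_abs_bound)
    also have "\<dots> \<le> (\<integral>x. 1 / n \<partial>\<nu>)"
      using fi gi close by (intro integral_mono) (auto simp: sp)
    also have "\<dots> \<le> \<epsilon>" using n by (simp add: \<nu>.prob_space)
    finally show "\<bar>(\<integral>x. f x \<partial>\<nu>) - (\<integral>x. g x \<partial>\<nu>)\<bar> \<le> \<epsilon>" .
  qed
  have "(\<lambda>j. \<integral>x. g x \<partial>\<sigma>s j) \<longlonglongrightarrow> (\<integral>x. g x \<partial>\<sigma>)"
    unfolding integrals(1)[OF assms(1) sets] integrals(1)[OF assms(2) refl]
    using n by (intro tendsto_intros setwise A) simp
  then show "\<exists>Y y. Y \<longlonglongrightarrow> y \<and> (\<forall>j. \<bar>(\<integral>x. f x \<partial>\<sigma>s j) - Y j\<bar> \<le> \<epsilon>) \<and> \<bar>(\<integral>x. f x \<partial>\<sigma>) - y\<bar> \<le> \<epsilon>"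
    using integrals(2) assms by blast
qed

text \<open>Fatou's lemma along varying measures: the bound passes to the limit for the bounded
  truncations \<open>min (g x) (real m)\<close>, and monotone convergence in \<open>m\<close>
  removes the truncation.\<close>

lemma setwise_limit_integral_le:
  fixes g :: "'a \<Rightarrow> real"
  assumes "\<And>j. prob_space (\<sigma>s j)" "prob_space \<sigma>" and sets: "\<And>j. sets (\<sigma>s j) = sets \<sigma>"
    and setwise: "\<And>B. B \<in> sets \<sigma> \<Longrightarrow> (\<lambda>j. measure (\<sigma>s j) B) \<longlonglongrightarrow> measure \<sigma> B"
    and g[measurable]: "g \<in> borel_measurable \<sigma>" and nn: "\<And>x. 0 \<le> g x"
    and int: "\<And>j. integrable (\<sigma>s j) g" "\<And>j. (\<integral>x. g x \<partial>\<sigma>s j) \<le> \<epsilon>"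
  shows "integrable \<sigma> g" "(\<integral>x. g x \<partial>\<sigma>) \<le> \<epsilon>"
proof -
  interpret \<sigma>: prob_space \<sigma> by fact
  let ?g = "\<lambda>m x. min (g x) (real m)"
  have g_int: "integrable \<sigma> (?g m)" for m
    by (rule \<sigma>.integrable_const_bound[of _ "real m"]) (auto simp: nn)
  have le: "(\<integral>x. ?g m x \<partial>\<sigma>) \<le> \<epsilon>" for m
  proof (rule LIMSEQ_le_const2)
    show "(\<lambda>j. \<integral>x. ?g m x \<partial>\<sigma>s j) \<longlonglongrightarrow> (\<integral>x. ?g m x \<partial>\<sigma>)"
      using nn by (intro setwise_tendsto_integral_bounded[of _ _ _ "real m"] assms(1,2) sets setwise) auto
    have "(\<integral>x. ?g m x \<partial>\<sigma>s j) \<le> (\<integral>x. g x \<partial>\<sigma>s j)" for j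
    proof -
      have [measurable]: "g \<in> borel_measurable (\<sigma>s j)"
        using int(1) by (rule borel_measurable_integrable)
      have "integrable (\<sigma>s j) (?g m)"
        using int(1)[of j]
        by (rule Bochner_Integration.integrable_bound) (auto simp: nn)
      then show ?thesis using int(1) by (intro integral_mono) auto
    qed
    then show "\<exists>N. \<forall>j\<ge>N. (\<integral>x. ?g m x \<partial>\<sigma>s j) \<le> \<epsilon>" using int(2) order_trans by blast
  qed
  \<comment> \<open>Monotone convergence for Bochner integrals asks for a finite limit of the
    integrals; the bound \<open>\<epsilon>\<close> provides it.\<close>
  have "incseq (\<lambda>m. \<integral>x. ?g m x \<partial>\<sigma>)"
    by (intro incseq_SucI integral_mono g_int) auto
  then obtain L where L: "(\<lambda>m. \<integral>x. ?g m x \<partial>\<sigma>) \<longlonglongrightarrow> L"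
    using incseq_convergent[of _ \<epsilon>] le by blast
  have lim: "AE x in \<sigma>. (\<lambda>m. ?g m x) \<longlonglongrightarrow> g x"
  proof (rule AE_I2)
    fix x
    have "?g m x = g x" if "nat \<lceil>g x\<rceil> \<le> m" for m using that by (simp add: min_def)
    then show "(\<lambda>m. ?g m x) \<longlonglongrightarrow> g x"
      by (intro tendsto_eventually) (unfold eventually_sequentially, blast)
  qed
  have mono: "AE x in \<sigma>. mono (\<lambda>m. ?g m x)"
    by (auto simp: mono_def)
  show "integrable \<sigma> g"
    using g_int mono lim L g by (rule integrable_monotone_convergence)
  have "(\<integral>x. g x \<partial>\<sigma>) = L"
    using g_int mono lim L g by (rule integral_monotone_convergence)
  then show "(\<integral>x. g x \<partial>\<sigma>) \<le> \<epsilon>"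
    using L le by (metis LIMSEQ_le_const2)
qed

section \<open>From weak to setwise convergence on the unit interval\<close>

lemma space_borel_prob_unit: "borel_prob_unit \<mu> \<Longrightarrow> space \<mu> = {0..1}"
  using sets_eq_imp_space_eq[of \<mu> unit_borel]
  by (simp add: borel_prob_unit_def unit_borel_def space_restrict_space)

lemma sets_unit_borel_iff: "A \<in> sets unit_borel \<longleftrightarrow> A \<in> sets borel \<and> A \<subseteq> {0..1}"
  by (auto simp: unit_borel_def sets_restrict_space_iff)

lemma radon_prob_unit_inner_approx:
  assumes R: "radon_prob_unit R" and A: "A \<in> sets R" and "0 < \<delta>"
  obtains K where "compact K" "K \<subseteq> A" "K \<in> sets R" "measure R (A - K) < \<delta>"
proof -
  interpret R: prob_space R using R by (simp add: radon_prob_unit_def borel_prob_unit_def)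
  have sets: "sets R = sets unit_borel"
    using R by (simp add: radon_prob_unit_def borel_prob_unit_def)
  \<comment> \<open>\<open>ennreal\<close> sends negative numbers to 0, hence the case split: if
    \<open>measure R A < \<delta>\<close> the empty set will do, otherwise the difference is
    nonnegative.\<close>
  have "\<exists>K. compact K \<and> K \<subseteq> A \<and> measure R A - \<delta> < measure R K"
  proof (cases "measure R A < \<delta>")
    case True
    then show ?thesis by (intro exI[of _ "{}"]) auto
  next
    case False
    have "ennreal (measure R A - \<delta>) < emeasure R A"
      using \<open>0 < \<delta>\<close> False by (simp add: R.emeasure_eq_measure ennreal_less_iff)
    also have "emeasure R A = (SUP K\<in>{K. compact K \<and> K \<subseteq> A}. emeasure R K)"
      using R A by (simp add: radon_prob_unit_def)
    finally obtain K where "compact K" "K \<subseteq> A" "ennreal (measure R A - \<delta>) < emeasure R K"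
      by (auto simp: less_SUP_iff)
    then show ?thesis
      using False by (auto simp: R.emeasure_eq_measure ennreal_less_iff)
  qed
  then obtain K where K: "compact K" "K \<subseteq> A" "measure R A - \<delta> < measure R K" by blast
  moreover have "K \<in> sets R"
    using K A by (auto simp: sets sets_unit_borel_iff intro: borel_compact)
  ultimately show thesis
    using that A by (simp add: R.finite_measure_Diff)
qed

lemma continuous_integrable_borel_prob_unit:
  fixes g :: "real \<Rightarrow> real"
  assumes \<mu>: "borel_prob_unit \<mu>" and g: "continuous_on {0..1} g"
  shows "integrable \<mu> g"
proof -
  interpret \<mu>: prob_space \<mu> using \<mu> by (simp add: borel_prob_unit_def)
  have "g \<in> borel_measurable (restrict_space borel {0..1})"
    using g by (rule borel_measurable_continuous_on_restrict)
  then have "g \<in> borel_measurable \<mu>"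
    using \<mu> measurable_cong_sets[of \<mu> unit_borel borel "borel :: real measure"]
    by (simp add: borel_prob_unit_def unit_borel_def)
  moreover have "bounded (g ` {0..1})"
    using g by (intro compact_imp_bounded compact_continuous_image) auto
  then obtain B where "\<And>x. x \<in> {0..1} \<Longrightarrow> norm (g x) \<le> B"
    unfolding bounded_iff by blast
  then have "AE x in \<mu>. norm (g x) \<le> B"
    by (intro AE_I2) (simp add: space_borel_prob_unit[OF \<mu>])
  ultimately show ?thesis by (intro \<mu>.integrable_const_bound)
qed

text \<open>An outer approximation by a relatively open set, whose indicator is an increasing limit of
  continuous functions, transfers the bound to the weak limit.\<close>

lemma weak_limit_uniform_absolute_continuity:
  assumes R: "radon_prob_unit R" and \<sigma>s: "\<And>j. borel_prob_unit (\<sigma>s j)"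
    and \<sigma>: "borel_prob_unit \<sigma>" and conv: "weak_conv_unit \<sigma>s \<sigma>"
    and uac: "\<And>A j. A \<in> sets R \<Longrightarrow> measure R A < \<delta> \<Longrightarrow> measure (\<sigma>s j) A < \<epsilon>"
    and A: "A \<in> sets R" "measure R A < \<delta>"
  shows "measure \<sigma> A \<le> \<epsilon>"
proof -
  interpret R: prob_space R using R by (simp add: radon_prob_unit_def borel_prob_unit_def)
  interpret \<sigma>: prob_space \<sigma> using \<sigma> by (simp add: borel_prob_unit_def)
  have R': "borel_prob_unit R" using R by (simp add: radon_prob_unit_def)
  note sp = space_borel_prob_unit[OF R'] space_borel_prob_unit[OF \<sigma>s] space_borel_prob_unit[OF \<sigma>]
  have sets: "sets (\<sigma>s j) = sets R" "sets \<sigma> = sets R" for j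
    using R' \<sigma>s \<sigma> by (simp_all add: borel_prob_unit_def)
  \<comment> \<open>A compact \<open>K\<close> in the complement of \<open>A\<close> makes
    \<open>U\<close> relatively open; the tolerance \<open>\<delta> - measure R A\<close> keeps
    \<open>measure R U\<close> below \<open>\<delta>\<close>.\<close>
  have "{0..1} - A \<in> sets R" using A sets.compl_sets[of A R] by (simp add: sp)
  then obtain K where K: "compact K" "K \<subseteq> {0..1} - A" "K \<in> sets R"
    "measure R ({0..1} - A - K) < \<delta> - measure R A"
    using radon_prob_unit_inner_approx[OF R] A by (metis diff_gt_0_iff_gt)
  define U where "U = {0..1} - K"
  have AU: "A \<subseteq> U" using K(2) sets.sets_into_space[OF A(1)] by (auto simp: U_def sp)
  have U[measurable]: "U \<in> sets R" using K sets.compl_sets[of K R] by (simp add: U_def sp)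
  have "{0..1} - A - K = U - A" by (auto simp: U_def)
  then have U_small: "measure R U < \<delta>"
    using K(4) R.finite_measure_Diff[OF U A(1) AU] by simp
  \<comment> \<open>With an empty second set, \<open>h\<close> vanishes exactly on \<open>K\<close>
    and is positive elsewhere, so on the unit interval \<open>min 1 (n * h x)\<close> increases to
    the indicator of \<open>U\<close>.\<close>
  obtain h :: "real \<Rightarrow> real" where h: "continuous_on UNIV h" "\<And>x. h x \<in> closed_segment 0 1"
    "\<And>x. h x = 0 \<longleftrightarrow> x \<in> K" "\<And>x. h x = 1 \<longleftrightarrow> x \<in> {}"
    by (rule Urysohn_strong[OF compact_imp_closed[OF K(1)] closed_empty, of "0::real" 1])
      (simp, simp, rule that)
  define g where "g n x = min 1 (real n * h x)" for n x
  have g_cont: "continuous_on {0..1} (g n)" for n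
    unfolding g_def by (intro continuous_intros continuous_on_subset[OF h(1)]) auto
  have h01: "0 \<le> h x" "h x \<le> 1" for x using h(2)[of x] by (auto simp: closed_segment_eq_real_ivl)
  have g01: "0 \<le> g n x" "g n x \<le> 1" for n x by (auto simp: g_def h01)
  have g_le: "g n x \<le> indicator U x" if "x \<in> {0..1}" for n x
    using that g01[of n x] h(3)[of x] by (auto simp: U_def g_def split: split_indicator)
  \<comment> \<open>For fixed \<open>n\<close> the bound holds for all \<open>j\<close>, so weak
    convergence hands it to \<open>\<sigma>\<close>; only afterwards does \<open>n\<close> tend to
    infinity.\<close>
  have "(\<integral>x. g n x \<partial>\<sigma>s j) \<le> \<epsilon>" for n j
  proof -
    interpret \<sigma>s: prob_space "\<sigma>s j" using \<sigma>s by (simp add: borel_prob_unit_def)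
    have "(\<integral>x. g n x \<partial>\<sigma>s j) \<le> (\<integral>x. indicator U x \<partial>\<sigma>s j)"
    proof (rule integral_mono)
      show "integrable (\<sigma>s j) (indicator U :: real \<Rightarrow> real)"
        by (rule integrable_real_indicator)
          (auto simp: sets \<sigma>s.emeasure_finite less_top[symmetric])
    qed (use g_le sp in \<open>auto intro: continuous_integrable_borel_prob_unit[OF \<sigma>s g_cont]\<close>)
    also have "\<dots> = measure (\<sigma>s j) U" using U by (simp add: sets)
    finally show ?thesis using uac[OF U U_small, of j] by simp
  qed
  moreover have "(\<lambda>j. \<integral>x. g n x \<partial>\<sigma>s j) \<longlonglongrightarrow> (\<integral>x. g n x \<partial>\<sigma>)" for n
    using conv g_cont by (simp add: weak_conv_unit_def)
  ultimately have g_\<sigma>: "(\<integral>x. g n x \<partial>\<sigma>) \<le> \<epsilon>" for n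
    by (meson LIMSEQ_le_const2)
  have "(\<lambda>n. \<integral>x. g n x \<partial>\<sigma>) \<longlonglongrightarrow> (\<integral>x. indicator U x \<partial>\<sigma>)"
  proof (rule integral_dominated_convergence[where w = "\<lambda>_. 1"])
    show "AE x in \<sigma>. (\<lambda>n. g n x) \<longlonglongrightarrow> indicator U x"
    proof (rule AE_I2)
      fix x assume x: "x \<in> space \<sigma>"
      show "(\<lambda>n. g n x) \<longlonglongrightarrow> indicator U x"
      proof (cases "x \<in> K")
        case True
        then show ?thesis using h(3)[of x] by (simp add: g_def U_def)
      next
        case False
        then have "0 < h x" using h(3)[of x] h01(1)[of x] by simp
        then obtain m :: nat where m: "1 < real m * h x" using reals_Archimedean3 by blast
        have "g n x = 1" if "m \<le> n" for n
        proof -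
          have "real m * h x \<le> real n * h x" using that h01(1)[of x] by (simp add: mult_right_mono)
          then show ?thesis using m by (simp add: g_def)
        qed
        then have "\<forall>\<^sub>F n in sequentially. g n x = 1" by (auto simp: eventually_sequentially)
        then show ?thesis using False x by (simp add: U_def sp tendsto_eventually)
      qed
    qed
  qed (use U g01 in \<open>auto simp: sets intro: borel_measurable_indicator borel_measurable_integrable
      continuous_integrable_borel_prob_unit[OF \<sigma> g_cont]\<close>)
  then have "(\<integral>x. indicator U x \<partial>\<sigma>) \<le> \<epsilon>"
    using g_\<sigma> by (meson LIMSEQ_le_const2)
  then have "measure \<sigma> U \<le> \<epsilon>" using U by (simp add: sets)
  then show ?thesis
    using \<sigma>.finite_measure_mono[OF AU] U by (simp add: sets)
qed

text \<open>Compact sets inside \<open>B\<close> and inside its complement are separated by a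
  Urysohn function, which differs from the indicator of \<open>B\<close> only on a set of small
  \<open>R\<close>-measure. Uniform absolute continuity makes this error small for all measures at
  once.\<close>

lemma weak_conv_unit_setwise:
  assumes R: "radon_prob_unit R" and \<sigma>s: "\<And>j. borel_prob_unit (\<sigma>s j)"
    and \<sigma>: "borel_prob_unit \<sigma>" and conv: "weak_conv_unit \<sigma>s \<sigma>"
    and uac: "\<And>\<epsilon>::real. 0 < \<epsilon> \<Longrightarrow>
      \<exists>\<delta>>0. \<forall>A j. A \<in> sets R \<longrightarrow> measure R A < \<delta> \<longrightarrow> measure (\<sigma>s j) A < \<epsilon>"
    and B: "B \<in> sets unit_borel"
  shows "(\<lambda>j. measure (\<sigma>s j) B) \<longlonglongrightarrow> measure \<sigma> B"
proof (rule tendsto_by_approximation)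
  fix \<epsilon> :: real assume "0 < \<epsilon>"
  then obtain \<delta> where "0 < \<delta>"
    and \<delta>: "\<And>A j. A \<in> sets R \<Longrightarrow> measure R A < \<delta> \<Longrightarrow> measure (\<sigma>s j) A < \<epsilon>"
    using uac by blast
  interpret R: prob_space R using R by (simp add: radon_prob_unit_def borel_prob_unit_def)
  have R': "borel_prob_unit R" using R by (simp add: radon_prob_unit_def)
  have sp: "space R = {0..1}" using R' by (rule space_borel_prob_unit)
  have sets: "sets R = sets unit_borel" using R' by (simp add: borel_prob_unit_def)
  have B'[measurable]: "B \<in> sets R" using B sets by simp
  then have Bc[measurable]: "{0..1} - B \<in> sets R" using sets.compl_sets[of B R] by (simp add: sp)
  \<comment> \<open>Each of the two inner approximations may miss half of \<open>\<delta>\<close>,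
    so that the gap \<open>W\<close> stays below \<open>\<delta>\<close>.\<close>
  have "0 < \<delta> / 2" using \<open>0 < \<delta>\<close> by simp
  note approxE = radon_prob_unit_inner_approx[OF R _ this]
  obtain K where K': "compact K" "K \<subseteq> B" and K[measurable]: "K \<in> sets R"
    and KB: "measure R (B - K) < \<delta> / 2"
    by (rule approxE[OF B'])
  obtain L where L': "compact L" "L \<subseteq> {0..1} - B" and L[measurable]: "L \<in> sets R"
    and LB: "measure R ({0..1} - B - L) < \<delta> / 2"
    by (rule approxE[OF Bc])
  define W where "W = (B - K) \<union> ({0..1} - B - L)"
  have W[measurable]: "W \<in> sets R" by (simp add: W_def sets.Un sets.Diff)
  have "measure R W \<le> measure R (B - K) + measure R ({0..1} - B - L)"
    unfolding W_def by (intro measure_Un_le sets.Diff B' Bc K L)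
  then have W_small: "measure R W < \<delta>" using KB LB by simp
  obtain g :: "real \<Rightarrow> real" where g: "continuous_on UNIV g" "\<And>x. g x \<in> closed_segment 0 1"
    "\<And>x. x \<in> L \<Longrightarrow> g x = 0" "\<And>x. x \<in> K \<Longrightarrow> g x = 1"
    using Urysohn[of L K "0::real" 1] compact_imp_closed[OF K'(1)] compact_imp_closed[OF L'(1)]
      K'(2) L'(2) by blast
  have g_cont: "continuous_on {0..1} g" using g(1) by (rule continuous_on_subset) simp
  have g01: "0 \<le> g x" "g x \<le> 1" for x using g(2)[of x] by (auto simp: closed_segment_eq_real_ivl)
  \<comment> \<open>On \<open>K\<close> and \<open>L\<close> the two functions agree; every other
    point of the interval lies in \<open>W\<close>, where both take values between 0 and 1.\<close>
  have close: "\<bar>indicator B x - g x\<bar> \<le> indicator W x" if "x \<in> {0..1}" for x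
    using that g(3,4)[of x] g01[of x] by (auto simp: W_def indicator_def)
  have approx: "\<bar>measure \<nu> B - (\<integral>x. g x \<partial>\<nu>)\<bar> \<le> measure \<nu> W" if \<nu>: "borel_prob_unit \<nu>" for \<nu>
  proof -
    interpret \<nu>: prob_space \<nu> using \<nu> by (simp add: borel_prob_unit_def)
    have [simp]: "sets \<nu> = sets R" using \<nu> sets by (simp add: borel_prob_unit_def)
    have ind: "integrable \<nu> (indicator S :: real \<Rightarrow> real)" if "S \<in> sets R" for S
      using that by (intro integrable_real_indicator)
        (auto simp: \<nu>.emeasure_finite less_top[symmetric])
    have gi: "integrable \<nu> g" using \<nu> g_cont by (rule continuous_integrable_borel_prob_unit)
    have "\<bar>measure \<nu> B - (\<integral>x. g x \<partial>\<nu>)\<bar> = \<bar>\<integral>x. indicator B x - g x \<partial>\<nu>\<bar>"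
      using gi ind[OF B'] B' by simp
    also have "\<dots> \<le> (\<integral>x. \<bar>indicator B x - g x\<bar> \<partial>\<nu>)" by (rule integral_abs_bound)
    also have "\<dots> \<le> (\<integral>x. indicator W x \<partial>\<nu>)"
      using gi ind[OF B'] ind[OF W] close
      by (intro integral_mono) (auto simp: space_borel_prob_unit[OF \<nu>])
    also have "\<dots> = measure \<nu> W" using W by simp
    finally show ?thesis .
  qed
  have "\<bar>measure (\<sigma>s j) B - (\<integral>x. g x \<partial>\<sigma>s j)\<bar> \<le> \<epsilon>" for j
    using approx[OF \<sigma>s] \<delta>[OF W W_small] by (meson less_imp_le order_trans)
  \<comment> \<open>No entropy bound is assumed for \<open>\<sigma>\<close>; its smallness on
    \<open>W\<close> is inherited through the weak limit.\<close>
  moreover have "\<bar>measure \<sigma> B - (\<integral>x. g x \<partial>\<sigma>)\<bar> \<le> \<epsilon>"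
    using approx[OF \<sigma>] weak_limit_uniform_absolute_continuity[OF R \<sigma>s \<sigma> conv \<delta> W W_small]
    by (rule order_trans)
  moreover have "(\<lambda>j. \<integral>x. g x \<partial>\<sigma>s j) \<longlonglongrightarrow> (\<integral>x. g x \<partial>\<sigma>)"
    using conv g_cont by (simp add: weak_conv_unit_def)
  ultimately show "\<exists>Y y. Y \<longlonglongrightarrow> y \<and> (\<forall>j. \<bar>measure (\<sigma>s j) B - Y j\<bar> \<le> \<epsilon>) \<and> \<bar>measure \<sigma> B - y\<bar> \<le> \<epsilon>"
    by blast
qed


section \<open>Exponential moments and uniform tails\<close>

text \<open>Because \<open>\<beta> > 1\<close>, \<open>\<alpha> * y powr \<beta>\<close> dominates
  \<open>t * y\<close> beyond a threshold, and below it \<open>exp (t * y)\<close> is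
  bounded.\<close>

lemma exp_moments_from_superlinear:
  fixes f :: "'a \<Rightarrow> real"
  assumes "prob_space R" and f[measurable]: "f \<in> borel_measurable R"
    and "0 < \<alpha>" "1 < \<beta>" and fin: "(\<integral>\<^sup>+u. ennreal (exp (\<alpha> * \<bar>f u\<bar> powr \<beta>)) \<partial>R) < \<infinity>" and "0 < t"
  shows "integrable R (\<lambda>u. exp (t * \<bar>f u\<bar>))"
proof -
  interpret R: prob_space R by fact
  \<comment> \<open>The threshold is the positive solution of
    \<open>t * y = \<alpha> * y powr \<beta>\<close>.\<close>
  define c where "c = (t / \<alpha>) powr (1 / (\<beta> - 1))"
  have le: "exp (t * y) \<le> exp (\<alpha> * y powr \<beta>) + exp (t * c)" if "0 \<le> y" for y
  proof (cases "y \<le> c")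
    case True
    then have "exp (t * y) \<le> exp (t * c)" using \<open>0 < t\<close> by simp
    then show ?thesis by (simp add: add_increasing)
  next
    case False
    have c: "0 < c" using \<open>0 < t\<close> \<open>0 < \<alpha>\<close> by (simp add: c_def)
    have "t / \<alpha> = c powr (\<beta> - 1)"
      using \<open>0 < t\<close> \<open>0 < \<alpha>\<close> \<open>1 < \<beta>\<close> by (simp add: c_def powr_powr)
    also have "\<dots> \<le> y powr (\<beta> - 1)" using False c \<open>1 < \<beta>\<close> by (intro powr_mono2) auto
    finally have "t \<le> \<alpha> * y powr (\<beta> - 1)" using \<open>0 < \<alpha>\<close> by (simp add: field_simps)
    then have "t * y \<le> \<alpha> * y powr (\<beta> - 1) * y" using that by (rule mult_right_mono)
    also have "\<dots> = \<alpha> * y powr \<beta>"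
      using False c by (simp add: powr_diff)
    finally have "exp (t * y) \<le> exp (\<alpha> * y powr \<beta>)" by simp
    then show ?thesis by (simp add: add_increasing2)
  qed
  have "integrable R (\<lambda>u. exp (\<alpha> * \<bar>f u\<bar> powr \<beta>))"
    using fin by (intro integrableI_nonneg) auto
  then have "integrable R (\<lambda>u. exp (\<alpha> * \<bar>f u\<bar> powr \<beta>) + exp (t * c))" by simp
  then show ?thesis
    by (rule Bochner_Integration.integrable_bound) (auto intro!: AE_I2 order_trans[OF le])
qed

text \<open>Duality is applied to the tail of \<open>\<bar>f\<bar>\<close>. For fixed
  \<open>t\<close> its exponential moment tends to 1 by dominated convergence; as this concerns
  \<open>R\<close> alone, one \<open>n\<close> serves all \<open>j\<close>.\<close>

lemma rel_entropy_uniform_tail: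
  fixes f :: "real \<Rightarrow> real"
  assumes R: "prob_space R" and \<sigma>s: "\<And>j::nat. prob_space (\<sigma>s j)" "\<And>j. sets (\<sigma>s j) = sets R"
    "\<And>j. rel_entropy (\<sigma>s j) R \<le> ereal C"
    and f[measurable]: "f \<in> borel_measurable R"
    and moments: "\<And>t. 0 < t \<Longrightarrow> integrable R (\<lambda>x. exp (t * \<bar>f x\<bar>))" and "0 < \<epsilon>"
  obtains n :: nat where
    "\<And>j. integrable (\<sigma>s j) (\<lambda>x. if n < \<bar>f x\<bar> then \<bar>f x\<bar> else 0)"
    "\<And>j. (\<integral>x. (if n < \<bar>f x\<bar> then \<bar>f x\<bar> else 0) \<partial>\<sigma>s j) \<le> \<epsilon>"
proof -
  interpret R: prob_space R by fact
  let ?g = "\<lambda>n x. if real n < \<bar>f x\<bar> then \<bar>f x\<bar> else 0"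
  \<comment> \<open>Once the moment is below 2, duality bounds \<open>t\<close> times the tail
    integral by \<open>C + 1\<close>, which is at most \<open>t * \<epsilon>\<close>.\<close>
  define t where "t = (\<bar>C\<bar> + 1) / \<epsilon>"
  have t: "0 < t" using \<open>0 < \<epsilon>\<close> by (auto simp: t_def intro!: divide_pos_pos)
  have dom: "norm (exp (t * ?g n x)) \<le> exp (t * \<bar>f x\<bar>)" for n x using t by simp
  have exp_int: "integrable R (\<lambda>x. exp (t * ?g n x))" for n
    using moments[OF t] by (rule Bochner_Integration.integrable_bound) (use dom in auto)
  have "(\<lambda>n. \<integral>x. exp (t * ?g n x) \<partial>R) \<longlonglongrightarrow> (\<integral>x. 1 \<partial>R)"
  proof (rule integral_dominated_convergence[OF _ _ moments[OF t]])
    show "AE x in R. (\<lambda>n. exp (t * ?g n x)) \<longlonglongrightarrow> 1"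
    proof (rule AE_I2)
      fix x
      have "exp (t * ?g n x) = 1" if "nat \<lceil>\<bar>f x\<bar>\<rceil> \<le> n" for n using that by auto
      then show "(\<lambda>n. exp (t * ?g n x)) \<longlonglongrightarrow> 1"
        by (intro tendsto_eventually) (unfold eventually_sequentially, blast)
    qed
  qed (use dom in auto)
  then have "(\<lambda>n. \<integral>x. exp (t * ?g n x) \<partial>R) \<longlonglongrightarrow> 1" by (simp add: R.prob_space)
  then have "\<forall>\<^sub>F n in sequentially. (\<integral>x. exp (t * ?g n x) \<partial>R) < 2"
    by (rule order_tendstoD) simp
  then obtain n where n: "(\<integral>x. exp (t * ?g n x) \<partial>R) < 2"
    by (auto simp: eventually_sequentially)
  have "?g n \<in> borel_measurable R" by measurable
  note dual = rel_entropy_duality[OF R \<sigma>s this _ t exp_int]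
  show thesis
  proof (rule that)
    show "integrable (\<sigma>s j) (?g n)" for j by (rule dual(1)) simp
    have "t * (\<integral>x. ?g n x \<partial>\<sigma>s j) \<le> C - 1 + (\<integral>x. exp (t * ?g n x) \<partial>R)" for j
      by (rule dual(2)) simp
    also have "C - 1 + (\<integral>x. exp (t * ?g n x) \<partial>R) \<le> t * \<epsilon>" using n \<open>0 < \<epsilon>\<close> by (simp add: t_def)
    finally show "(\<integral>x. ?g n x \<partial>\<sigma>s j) \<le> \<epsilon>" for j using t by simp
  qed
qed

section \<open>Truncation and passage to the limit\<close>

text \<open>Integrability is part of the conclusion because the Bochner integral of a non-integrable
  function is 0 by default.\<close>

theorem theorem8p3:
  fixes R \<sigma> :: "real measure" and \<sigma>s :: "nat \<Rightarrow> real measure"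
  assumes "radon_prob_unit R"
    and "\<And>j. borel_prob_unit (\<sigma>s j)"
    and "borel_prob_unit \<sigma>"
    and "\<exists>C::real. \<forall>j. rel_entropy (\<sigma>s j) R \<le> ereal C"
    and "weak_conv_unit \<sigma>s \<sigma>"
  shows "(\<forall>f::real \<Rightarrow> real. f \<in> borel_measurable unit_borel \<longrightarrow>
            (\<exists>\<alpha>>0. \<exists>\<beta>>1. (\<integral>\<^sup>+u. ennreal (exp (\<alpha> * \<bar>f u\<bar> powr \<beta>)) \<partial>R) < \<infinity>) \<longrightarrow>
            (\<forall>j. integrable (\<sigma>s j) f) \<and> integrable \<sigma> f \<and>
            (\<lambda>j. \<integral>u. f u \<partial>\<sigma>s j) \<longlonglongrightarrow> (\<integral>u. f u \<partial>\<sigma>)) \<and>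
         (\<forall>B\<in>sets unit_borel. (\<lambda>j. measure (\<sigma>s j) B) \<longlonglongrightarrow> measure \<sigma> B)"
proof -
  obtain C where C: "\<And>j. rel_entropy (\<sigma>s j) R \<le> ereal C" using assms(4) by blast
  have prob: "prob_space R" "\<And>j. prob_space (\<sigma>s j)" "prob_space \<sigma>"
    and sets: "sets R = sets unit_borel" "\<And>j. sets (\<sigma>s j) = sets unit_borel"
      "sets \<sigma> = sets unit_borel"
    using assms(1-3) by (simp_all add: radon_prob_unit_def borel_prob_unit_def)
  have sets_R: "\<And>j. sets (\<sigma>s j) = sets R" and sets_\<sigma>: "\<And>j. sets (\<sigma>s j) = sets \<sigma>"
    by (simp_all add: sets)
  have setwise: "(\<lambda>j. measure (\<sigma>s j) B) \<longlonglongrightarrow> measure \<sigma> B" if "B \<in> sets unit_borel" for B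
  proof (rule weak_conv_unit_setwise[OF assms(1-3,5) _ that])
    fix \<epsilon> :: real assume "0 < \<epsilon>"
    show "\<exists>\<delta>>0. \<forall>A j. A \<in> sets R \<longrightarrow> measure R A < \<delta> \<longrightarrow> measure (\<sigma>s j) A < \<epsilon>"
      by (rule rel_entropy_uniform_absolute_continuity[where \<sigma>s = \<sigma>s, OF prob(1,2) sets_R C \<open>0 < \<epsilon>\<close>]) blast
  qed
  then have setwise_\<sigma>: "(\<lambda>j. measure (\<sigma>s j) B) \<longlonglongrightarrow> measure \<sigma> B" if "B \<in> sets \<sigma>" for B
    using that by (simp add: sets)
  have "(\<forall>j. integrable (\<sigma>s j) f) \<and> integrable \<sigma> f \<and>
      (\<lambda>j. \<integral>u. f u \<partial>\<sigma>s j) \<longlonglongrightarrow> (\<integral>u. f u \<partial>\<sigma>)"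
    if f: "f \<in> borel_measurable unit_borel" and "0 < \<alpha>" "1 < \<beta>"
      and fin: "(\<integral>\<^sup>+u. ennreal (exp (\<alpha> * \<bar>f u\<bar> powr \<beta>)) \<partial>R) < \<infinity>" for f :: "real \<Rightarrow> real" and \<alpha> \<beta>
  proof -
    have meas: "f \<in> borel_measurable \<nu>" if "sets \<nu> = sets unit_borel" for \<nu>
      using f measurable_cong_sets[OF that refl] by blast
    \<comment> \<open>\<open>?f n\<close> is \<open>f\<close> cut off where
      \<open>\<bar>f\<bar>\<close> exceeds \<open>n\<close>, and \<open>?g n\<close> is exactly the
      absolute value of what is lost.\<close>
    let ?g = "\<lambda>n x. if real n < \<bar>f x\<bar> then \<bar>f x\<bar> else 0"
    let ?f = "\<lambda>n x. if real n < \<bar>f x\<bar> then 0 else f x"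
    have f_int: "integrable \<nu> f" "integrable \<nu> (?f n)"
        "\<bar>(\<integral>x. f x \<partial>\<nu>) - (\<integral>x. ?f n x \<partial>\<nu>)\<bar> \<le> (\<integral>x. ?g n x \<partial>\<nu>)"
      if "prob_space \<nu>" "sets \<nu> = sets unit_borel" "integrable \<nu> (?g n)" for \<nu> n
    proof -
      interpret \<nu>: prob_space \<nu> by fact
      have [measurable]: "f \<in> borel_measurable \<nu>" using that(2) by (rule meas)
      \<comment> \<open>\<open>\<bar>f\<bar> \<le> n + ?g n\<close> pointwise, so integrability of
        the tail suffices for \<open>f\<close>.\<close>
      have "integrable \<nu> (\<lambda>x. real n + ?g n x)" using that(3) by simp
      then show f1: "integrable \<nu> f" by (rule Bochner_Integration.integrable_bound) auto
      show f2: "integrable \<nu> (?f n)"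
        by (rule \<nu>.integrable_const_bound[of _ "real n"]) auto
      have "\<bar>(\<integral>x. f x \<partial>\<nu>) - (\<integral>x. ?f n x \<partial>\<nu>)\<bar> = \<bar>\<integral>x. f x - ?f n x \<partial>\<nu>\<bar>"
        using f1 f2 by simp
      also have "\<dots> \<le> (\<integral>x. \<bar>f x - ?f n x\<bar> \<partial>\<nu>)" by (rule integral_abs_bound)
      also have "(\<lambda>x. \<bar>f x - ?f n x\<bar>) = ?g n" by auto
      finally show "\<bar>(\<integral>x. f x \<partial>\<nu>) - (\<integral>x. ?f n x \<partial>\<nu>)\<bar> \<le> (\<integral>x. ?g n x \<partial>\<nu>)" .
    qed
    \<comment> \<open>A common \<open>n\<close> has to serve \<open>\<sigma>\<close> too; its tail
      bound comes from those of the \<open>\<sigma>s j\<close> by the Fatou-type lemma.\<close>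
    have tail: "\<exists>n. \<forall>\<nu>\<in>insert \<sigma> (range \<sigma>s). integrable \<nu> (?g n) \<and> (\<integral>x. ?g n x \<partial>\<nu>) \<le> \<epsilon>"
      if "0 < \<epsilon>" for \<epsilon> :: real
    proof (rule rel_entropy_uniform_tail[where \<sigma>s = \<sigma>s, OF prob(1,2) sets_R C
          meas[OF sets(1)] _ that])
      show "integrable R (\<lambda>x. exp (t * \<bar>f x\<bar>))" if "0 < t" for t
        using prob(1) meas[OF sets(1)] \<open>0 < \<alpha>\<close> \<open>1 < \<beta>\<close> fin that
        by (rule exp_moments_from_superlinear)
    next
      fix n assume n: "\<And>j. integrable (\<sigma>s j) (?g n)" "\<And>j. (\<integral>x. ?g n x \<partial>\<sigma>s j) \<le> \<epsilon>"
      have "?g n \<in> borel_measurable \<sigma>" using meas[OF sets(3)] by measurable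
      note lim = setwise_limit_integral_le[OF prob(2,3) sets_\<sigma> setwise_\<sigma> this _ n]
      have "integrable \<sigma> (?g n)" by (rule lim(1)) simp_all
      moreover have "(\<integral>x. ?g n x \<partial>\<sigma>) \<le> \<epsilon>" by (rule lim(2)) simp_all
      ultimately show ?thesis using n by blast
    qed
    have "(\<lambda>j. \<integral>u. f u \<partial>\<sigma>s j) \<longlonglongrightarrow> (\<integral>u. f u \<partial>\<sigma>)"
    proof (rule tendsto_by_approximation)
      fix \<epsilon> :: real assume "0 < \<epsilon>"
      then obtain n where n: "\<And>\<nu>. \<nu> \<in> insert \<sigma> (range \<sigma>s) \<Longrightarrow>
          integrable \<nu> (?g n) \<and> (\<integral>x. ?g n x \<partial>\<nu>) \<le> \<epsilon>"
        using tail by blast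
      have "?f n \<in> borel_measurable \<sigma>" using meas[OF sets(3)] by measurable
      note lim = setwise_tendsto_integral_bounded[where M = "real n",
          OF prob(2,3) sets_\<sigma> setwise_\<sigma> this]
      have "(\<lambda>j. \<integral>x. ?f n x \<partial>\<sigma>s j) \<longlonglongrightarrow> (\<integral>x. ?f n x \<partial>\<sigma>)"
        by (rule lim) auto
      moreover have "\<bar>(\<integral>x. f x \<partial>\<sigma>s j) - (\<integral>x. ?f n x \<partial>\<sigma>s j)\<bar> \<le> \<epsilon>" for j
        using f_int(3)[OF prob(2) sets(2)] n[of "\<sigma>s j"] order_trans by blast
      moreover have "\<bar>(\<integral>x. f x \<partial>\<sigma>) - (\<integral>x. ?f n x \<partial>\<sigma>)\<bar> \<le> \<epsilon>"
        using f_int(3)[OF prob(3) sets(3)] n[of \<sigma>] order_trans by blast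
      ultimately show "\<exists>Y y. Y \<longlonglongrightarrow> y \<and> (\<forall>j. \<bar>(\<integral>x. f x \<partial>\<sigma>s j) - Y j\<bar> \<le> \<epsilon>) \<and>
          \<bar>(\<integral>x. f x \<partial>\<sigma>) - y\<bar> \<le> \<epsilon>"
        by blast
    qed
    \<comment> \<open>For integrability any tail level will do, so the tolerance 1 is
      arbitrary.\<close>
    moreover obtain n where "\<And>\<nu>. \<nu> \<in> insert \<sigma> (range \<sigma>s) \<Longrightarrow> integrable \<nu> (?g n)"
      using tail[of 1] by auto
    then have "integrable (\<sigma>s j) f" "integrable \<sigma> f" for j
      using f_int(1)[OF prob(2) sets(2)] f_int(1)[OF prob(3) sets(3)] by blast+
    ultimately show ?thesis by blast
  qed
  then show ?thesis using setwise by blast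
qed

end
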